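(* Let $j\ge 0$ be an integer. For every integer $n\ge 0$, the number of partitions of $n$ belonging to $\mathcal{M}_j$ is equal to the number of partitions of $n$ belonging to $\mathcal{F}_j$.
   Context: A partition is a finite non-increasing sequence $\lambda=(\lambda_1,\dots,\lambda_s)$ of positive integers (possibly empty); $\ell(\lambda)=s$ is its length and $|\lambda|=\lambda_1+\cdots+\lambda_s$ its weight; a partition of $n$ is a partition of weight $n$. For an integer $j\ge 0$, $mex_j(\lambda)$ is the smallest integer greater than $j$ which is not a part of $\lambda$ (defined for every partition $\lambda$, whether or not $j$ is a part of it). $\mathcal{M}_j$ is the set of partitions $\lambda$ such that $mex_j(\lambda)$ and $j$ have different parities, i.e. $mex_j(\lambda)-j$ is odd. $\mathcal{F}_j$ is the set of partitions $\lambda$ such that $j\notin\{\lambda_i-i : 1\le i\le \ell(\lambda)\}$. *)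

theory Defs
  imports Main
begin

definition is_partition :: "nat list \<Rightarrow> bool" where
  "is_partition xs \<longleftrightarrow> sorted_wrt (\<ge>) xs \<and> (\<forall>x\<in>set xs. 0 < x)"

definition partitions_of :: "nat \<Rightarrow> nat list set" where
  "partitions_of n = {xs. is_partition xs \<and> sum_list xs = n}"

definition mex :: "nat \<Rightarrow> nat list \<Rightarrow> nat" where
  "mex j xs = (LEAST m. j < m \<and> m \<notin> set xs)"

definition mex_partitions :: "nat \<Rightarrow> nat list set" where
  "mex_partitions j = {xs. is_partition xs \<and> even (mex j xs) \<noteq> even j}"

text \<open>
  The parts are \<open>xs ! (i - 1)\<close> for \<open>i = 1, \<dots>, length xs\<close>; the differences are taken in the
  integers because they may be negative.
\<close>

definition fixed_point_free_partitions :: "nat \<Rightarrow> nat list set" where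
  "fixed_point_free_partitions j =
     {xs. is_partition xs \<and> int j \<notin> {int (xs ! (i - 1)) - int i | i. 1 \<le> i \<and> i \<le> length xs}}"

text \<open>The sets counted by \<open>card\<close> are finite, and the minimum defining \<open>mex\<close> is attained.\<close>

lemma finite_partitions_of: "finite (partitions_of n)"
proof (rule finite_subset)
  have len: "length xs \<le> sum_list xs" if "\<forall>x\<in>set xs. 0 < x" for xs :: "nat list"
    using that by (induction xs) auto
  show "partitions_of n \<subseteq> {xs. set xs \<subseteq> {..n} \<and> length xs \<le> n}"
    by (auto simp: partitions_of_def is_partition_def len member_le_sum_list)
  show "finite {xs. set xs \<subseteq> {..n} \<and> length xs \<le> n}"
    by (rule finite_lists_length_le) simp
qed

lemma mex_greater: "j < mex j xs" and mex_notin: "mex j xs \<notin> set xs"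
proof -
  have "infinite ({j<..} - set xs)"
    by (simp add: infinite_Ioi)
  then obtain m where "j < m \<and> m \<notin> set xs"
    by (metis Diff_iff greaterThan_iff ex_in_conv finite.emptyI)
  then have "j < mex j xs \<and> mex j xs \<notin> set xs"
    unfolding mex_def by (rule LeastI)
  then show "j < mex j xs" "mex j xs \<notin> set xs" by auto
qed

end

theory Submission
  imports Defs "HOL-Library.Multiset"
begin

text \<open>
  Let \<open>m j n\<close> and \<open>f j n\<close> be the two cardinalities and \<open>p n\<close> the number of partitions of \<open>n\<close>.
  Both satisfy the recursion \<open>m j n = p n - m (j + 1) (n - (j + 1))\<close>, the subtracted term being
  \<open>0\<close> if \<open>n \<le> j\<close>, so they agree by induction on \<open>n\<close>.

  If \<open>mex j\<close> and \<open>j\<close> have the same parity then \<open>j + 1\<close> is a part, and deleting one copy of it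
  leaves a partition whose \<open>mex (j + 1)\<close> and \<open>j + 1\<close> have different parities.
  If \<open>\<lambda>\<^sub>i = i + j\<close>, then deleting \<open>\<lambda>\<^sub>i\<close> and adding \<open>1\<close> to each of the \<open>i - 1\<close> parts before it
  removes \<open>j + 1\<close> from the weight. In the result \<open>\<mu>\<close> we have \<open>\<mu>\<^sub>k - k \<ge> j + 2\<close> for \<open>k < i\<close> and
  \<open>\<mu>\<^sub>k - k \<le> j\<close> for \<open>k \<ge> i\<close>, so \<open>j + 1\<close> is avoided and \<open>i\<close> can be recovered.
\<close>

section \<open>Partitions as non-increasing lists\<close>

lemma is_partition_append_Cons:
  "is_partition (as @ p # bs) \<longleftrightarrow> is_partition as \<and> is_partition bs \<and> 0 < p \<and>
     (\<forall>x\<in>set as. p \<le> x) \<and> (\<forall>x\<in>set bs. x \<le> p)"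
  unfolding is_partition_def by (auto simp: sorted_wrt_append) (meson le_trans)

lemma is_partition_append:
  "is_partition (as @ bs) \<longleftrightarrow> is_partition as \<and> is_partition bs \<and>
     (\<forall>x\<in>set as. \<forall>y\<in>set bs. y \<le> x)"
  unfolding is_partition_def by (auto simp: sorted_wrt_append)

lemma is_partition_nth_mono:
  assumes "is_partition xs" "i \<le> k" "k < length xs"
  shows "xs ! k \<le> xs ! i"
  using assms unfolding is_partition_def sorted_wrt_iff_nth_less
  by (metis le_neq_implies_less order_refl)

lemma is_partition_iff_sorted_rev:
  "is_partition xs \<longleftrightarrow> sorted (rev xs) \<and> (\<forall>x\<in>set xs. 0 < x)"
  by (simp add: is_partition_def sorted_wrt_rev)

text \<open>A sorted list is determined by its multiset of entries. This lets insertion and deletion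
  of a part be checked on multisets alone.\<close>

lemma is_partition_eqI_mset:
  assumes "is_partition xs" "is_partition ys" "mset xs = mset ys"
  shows "xs = ys"
proof -
  have "rev xs = rev ys"
    using assms properties_for_sort[of "rev xs" "rev ys"] sorted_sort_id[of "rev ys"]
    by (simp add: is_partition_iff_sorted_rev)
  then show ?thesis by simp
qed

section \<open>The recursion for \<open>mex\<close>\<close>

lemma mex_cong:
  assumes "set xs \<inter> {j<..} = set ys \<inter> {j<..}"
  shows "mex j xs = mex j ys"
proof -
  have "(j < m \<and> m \<notin> set xs) = (j < m \<and> m \<notin> set ys)" for m
    using assms by auto
  then show ?thesis by (simp add: mex_def)
qed

lemma mex_eq_Suc: "Suc j \<notin> set xs \<Longrightarrow> mex j xs = Suc j"
  unfolding mex_def by (rule Least_equality) auto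

lemma mex_step:
  assumes "Suc j \<in> set xs"
  shows "mex j xs = mex (Suc j) xs"
proof -
  have "(j < m \<and> m \<notin> set xs) = (Suc j < m \<and> m \<notin> set xs)" for m
    using assms by (metis Suc_lessD Suc_lessI)
  then show ?thesis by (simp add: mex_def)
qed

text \<open>If \<open>Suc j\<close> is missing, it is itself the value of \<open>mex j\<close>, of
  the wrong parity. If it is present, \<open>mex j\<close> and \<open>mex (Suc j)\<close> coincide,
  and the parity condition on the right is the one defining
  \<open>mex_partitions (Suc j)\<close>.\<close>

lemma not_mex_partitions_iff:
  assumes "is_partition xs"
  shows "xs \<notin> mex_partitions j \<longleftrightarrow> Suc j \<in> set xs \<and> even (mex (Suc j) xs) = even j"
  using assms mex_eq_Suc[of j xs] mex_step[of j xs]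
  by (cases "Suc j \<in> set xs") (auto simp: mex_partitions_def)

lemma card_not_mex_partitions:
  "card (partitions_of (n + Suc j) - mex_partitions j) =
   card (partitions_of n \<inter> mex_partitions (Suc j))"
proof -
  \<comment> \<open>\<open>insort\<close> keeps ascending lists sorted, hence the two reversals. An
    extra copy of \<open>Suc j\<close> cannot affect \<open>mex (Suc j)\<close>, which only looks at
    larger numbers.\<close>
  define ins where "ins = (\<lambda>xs. rev (insort (Suc j) (rev xs)))"
  have mset_ins: "mset (ins xs) = add_mset (Suc j) (mset xs)" for xs
    by (simp add: ins_def)
  then have set_ins: "set (ins xs) = insert (Suc j) (set xs)" for xs
    by (metis set_mset_add_mset_insert set_mset_mset)
  have sum_ins: "sum_list (ins xs) = Suc j + sum_list xs" for xs
    using mset_ins[of xs] sum_mset_sum_list[of "ins xs"] sum_mset_sum_list[of xs] by simp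
  have part_ins: "is_partition (ins xs)" if "is_partition xs" for xs
    using that set_ins by (auto simp: is_partition_iff_sorted_rev ins_def sorted_insort)
  have mex_ins: "mex (Suc j) (ins xs) = mex (Suc j) xs" for xs
    by (rule mex_cong) (auto simp: set_ins)
  let ?A = "partitions_of n \<inter> mex_partitions (Suc j)"
  let ?B = "partitions_of (n + Suc j) - mex_partitions j"
  have "bij_betw ins ?A ?B"
  proof (rule bij_betw_imageI)
    show "inj_on ins ?A"
    proof (rule inj_onI)
      fix xs ys assume "xs \<in> ?A" "ys \<in> ?A" and eq: "ins xs = ins ys"
      then have "is_partition xs" "is_partition ys" by (auto simp: partitions_of_def)
      moreover have "mset xs = mset ys"
        using mset_ins[of xs] mset_ins[of ys] eq by simp
      ultimately show "xs = ys" by (rule is_partition_eqI_mset)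
    qed
    show "ins ` ?A = ?B"
    proof (intro equalityI subsetI)
      fix zs assume "zs \<in> ins ` ?A"
      then obtain xs where xs: "zs = ins xs" "is_partition xs" "sum_list xs = n"
          "even (mex (Suc j) xs) = even j"
        by (auto simp: partitions_of_def mex_partitions_def)
      then show "zs \<in> ?B"
        by (simp add: partitions_of_def part_ins sum_ins not_mex_partitions_iff set_ins mex_ins)
    next
      fix zs assume zs: "zs \<in> ?B"
      then have part: "is_partition zs" and sum: "sum_list zs = n + Suc j"
        by (auto simp: partitions_of_def)
      have mem: "Suc j \<in> set zs" and par: "even (mex (Suc j) zs) = even j"
        using zs not_mex_partitions_iff[OF part] by auto
      define xs where "xs = remove1 (Suc j) zs"
      obtain as bs where split: "zs = as @ Suc j # bs" "Suc j \<notin> set as"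
        using mem by (meson split_list_first)
      then have xs_eq: "xs = as @ bs"
        by (simp add: xs_def remove1_append)
      have "is_partition xs"
        using part unfolding split xs_eq is_partition_def by (simp add: sorted_wrt_append)
      moreover have "ins xs = zs"
        using calculation part
        by (intro is_partition_eqI_mset part_ins) (simp_all add: mset_ins xs_eq split)
      ultimately show "zs \<in> ins ` ?A"
        using sum sum_ins[of xs] mex_ins[of xs] par
        by (intro image_eqI[of _ _ xs]) (auto simp: partitions_of_def mex_partitions_def)
    qed
  qed
  then show ?thesis
    by (simp add: bij_betw_same_card)
qed

section \<open>The recursion for fixed points\<close>

lemma fixed_point_free_partitions_iff:
  "xs \<in> fixed_point_free_partitions j \<longleftrightarrow>
     is_partition xs \<and> (\<forall>k<length xs. xs ! k \<noteq> k + Suc j)"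
proof -
  \<comment> \<open>List positions start at 0, so \<open>i = Suc k\<close> and the offset
    \<open>j\<close> becomes \<open>Suc j\<close>.\<close>
  have "int j \<in> {int (xs ! (i - 1)) - int i | i. 1 \<le> i \<and> i \<le> length xs} \<longleftrightarrow>
      (\<exists>k<length xs. xs ! k = k + Suc j)" (is "?L \<longleftrightarrow> ?R")
  proof
    assume ?L
    then obtain i where "int j = int (xs ! (i - 1)) - int i" "1 \<le> i" "i \<le> length xs"
      by blast
    then show ?R by (intro exI[of _ "i - 1"]) auto
  next
    assume ?R
    then obtain k where "k < length xs" "xs ! k = k + Suc j" by blast
    then show ?L by (intro CollectI exI[of _ "Suc k"]) auto
  qed
  then show ?thesis
    unfolding fixed_point_free_partitions_def by auto
qed

lemma not_fixed_point_free_iff: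
  assumes "is_partition xs"
  shows "xs \<notin> fixed_point_free_partitions j \<longleftrightarrow>
    (\<exists>as bs. xs = as @ (length as + Suc j) # bs)"
proof
  assume "xs \<notin> fixed_point_free_partitions j"
  then obtain k where "k < length xs" "xs ! k = k + Suc j"
    using assms fixed_point_free_partitions_iff by blast
  then have "xs = take k xs @ (length (take k xs) + Suc j) # drop (Suc k) xs"
    using id_take_nth_drop[of k xs] by simp
  then show "\<exists>as bs. xs = as @ (length as + Suc j) # bs" by blast
next
  assume "\<exists>as bs. xs = as @ (length as + Suc j) # bs"
  then obtain as bs where "xs = as @ (length as + Suc j) # bs" by blast
  then have "length as < length xs" "xs ! length as = length as + Suc j" by auto
  then show "xs \<notin> fixed_point_free_partitions j"
    unfolding fixed_point_free_partitions_iff by blast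
qed

text \<open>This inverts the deletion: the cut is at the first position \<open>k\<close> whose entry
  is at most \<open>k + Suc j\<close>, and 1 is subtracted from every entry before it.\<close>

lemma fixed_point_free_split:
  assumes "ys \<in> fixed_point_free_partitions (Suc j)"
  obtains as bs where "ys = map Suc as @ bs"
    "\<forall>x\<in>set as. length as + Suc j \<le> x" "\<forall>x\<in>set bs. x \<le> length as + Suc j"
proof -
  have part: "is_partition ys" and free: "\<And>k. k < length ys \<Longrightarrow> ys ! k \<noteq> k + Suc (Suc j)"
    using assms by (auto simp: fixed_point_free_partitions_iff)
  \<comment> \<open>The first disjunct puts the cut at the end if every entry is large.\<close>
  let ?P = "\<lambda>k. k = length ys \<or> k < length ys \<and> ys ! k \<le> k + Suc j"
  define k where "k = (LEAST k. ?P k)"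
  have Pk: "?P k"
    unfolding k_def by (rule LeastI[of ?P "length ys"]) simp
  then have k: "k \<le> length ys" by auto
  have large: "k + Suc j < x" if x: "x \<in> set (take k ys)" for x
  proof -
    obtain i where i: "i < k" "x = ys ! i"
      using x k by (auto simp: in_set_conv_nth)
    have "\<not> ?P (k - 1)"
      using i(1) not_less_Least[of "k - 1" ?P] by (simp add: k_def)
    moreover have "k - 1 < length ys" using i(1) k by simp
    \<comment> \<open>Minimality of \<open>k\<close> gives only \<le> here; equality is what
      \<open>free\<close> forbids at \<open>k - 1\<close>. The strict bound leaves room for
      subtracting 1.\<close>
    ultimately have "k + Suc j < ys ! (k - 1)"
      using free[of "k - 1"] i(1) by simp
    also have "\<dots> \<le> x"
      using is_partition_nth_mono[OF part, of i "k - 1"] i k by auto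
    finally show ?thesis .
  qed
  have small: "x \<le> k + Suc j" if x: "x \<in> set (drop k ys)" for x
  proof -
    obtain i where i: "k \<le> i" "i < length ys" "x = ys ! i"
      using x k by (auto simp: in_set_conv_nth) (metis add.commute le_add1 less_diff_conv)
    then show ?thesis
      using Pk is_partition_nth_mono[OF part, of k i] by auto
  qed
  let ?as = "map (\<lambda>x. x - 1) (take k ys)"
  have len: "length ?as = k" using k by simp
  have "map Suc ?as = take k ys"
    using large by (force simp: o_def intro: map_idI)
  then have "ys = map Suc ?as @ drop k ys" by simp
  moreover have "\<forall>x\<in>set ?as. length ?as + Suc j \<le> x"
    unfolding len using large by fastforce
  moreover have "\<forall>x\<in>set (drop k ys). x \<le> length ?as + Suc j"
    unfolding len using small by blast
  ultimately show ?thesis by (rule that)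
qed

text \<open>If \<open>cs\<close> were longer, the entry at position \<open>length as\<close> would
  lie in \<open>bs\<close>, so be at most \<open>length as + c\<close>, and also be the successor of
  an entry of \<open>cs\<close>, so exceed \<open>length cs + c\<close>. Exchanging the roles gives
  equal lengths.\<close>

lemma map_Suc_append_split_unique:
  assumes "map Suc as @ bs = map Suc cs @ ds"
    and "\<forall>x\<in>set bs. x \<le> length as + c" and "\<forall>x\<in>set cs. length cs + c \<le> x"
  shows "length cs \<le> length as"
proof (rule ccontr)
  let ?k = "length as"
  assume neg: "\<not> length cs \<le> ?k"
  then have "(map Suc cs @ ds) ! ?k = Suc (cs ! ?k)" "cs ! ?k \<in> set cs"
    by (auto simp: nth_append)
  moreover have "?k < length (map Suc as @ bs)"
    unfolding assms(1) using neg by simp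
  then have "(map Suc as @ bs) ! ?k \<in> set bs"
    by (simp add: nth_append)
  ultimately show False
    using assms neg by fastforce
qed

text \<open>Both sets are parametrized by the pairs \<open>(as, bs)\<close> of parts before and
  after the deleted one: \<open>f\<close> puts that part back, \<open>g\<close> raises the parts
  before it.\<close>

lemma card_not_fixed_point_free:
  "card (partitions_of (n + Suc j) - fixed_point_free_partitions j) =
   card (partitions_of n \<inter> fixed_point_free_partitions (Suc j))"
proof -
  define C where "C = {(as, bs). is_partition (as @ (length as + Suc j) # bs) \<and>
    length as + sum_list as + sum_list bs = n}"
  define f where "f = (\<lambda>(as, bs). as @ (length as + Suc j) # bs)"
  define g where "g = (\<lambda>(as :: nat list, bs). map Suc as @ bs)"
  have sum_map_Suc: "sum_list (map Suc as) = length as + sum_list as" for as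
    by (induction as) auto
  have "bij_betw f C (partitions_of (n + Suc j) - fixed_point_free_partitions j)"
  proof (rule bij_betw_imageI)
    \<comment> \<open>Otherwise \<open>length cs + Suc j\<close> is an entry of \<open>as\<close>,
      yet smaller than the part \<open>length as + Suc j\<close> that follows
      \<open>as\<close>.\<close>
    have le: "length as \<le> length cs"
      if "is_partition (as @ (length as + Suc j) # bs)"
        and eq: "as @ (length as + Suc j) # bs = cs @ (length cs + Suc j) # ds" for as bs cs ds
    proof (rule ccontr)
      assume "\<not> length as \<le> length cs"
      moreover have "(as @ (length as + Suc j) # bs) ! length cs = length cs + Suc j"
        unfolding eq by simp
      ultimately have "length cs + Suc j \<in> set as" "length cs < length as"
        by (auto simp: nth_append) (metis not_le nth_mem)
      then show False
        using that(1) by (fastforce simp: is_partition_append_Cons)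
    qed
    show "inj_on f C"
    proof (rule inj_onI, clarify)
      fix as bs cs ds
      assume C: "(as, bs) \<in> C" "(cs, ds) \<in> C" and eq: "f (as, bs) = f (cs, ds)"
      have "length as = length cs"
        using C eq by (intro le_antisym le[of as bs cs ds] le[of cs ds as bs])
          (simp_all add: C_def f_def)
      then show "as = cs \<and> bs = ds"
        using eq by (simp add: f_def)
    qed
    show "f ` C = partitions_of (n + Suc j) - fixed_point_free_partitions j"
    proof (intro equalityI subsetI)
      fix zs assume "zs \<in> f ` C"
      then obtain as bs where "zs = as @ (length as + Suc j) # bs" "is_partition zs"
          "length as + sum_list as + sum_list bs = n"
        by (auto simp: C_def f_def)
      then show "zs \<in> partitions_of (n + Suc j) - fixed_point_free_partitions j"
        using not_fixed_point_free_iff[of zs j] by (auto simp: partitions_of_def)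
    next
      fix zs assume zs: "zs \<in> partitions_of (n + Suc j) - fixed_point_free_partitions j"
      then obtain as bs where "zs = as @ (length as + Suc j) # bs"
        using not_fixed_point_free_iff[of zs j] by (auto simp: partitions_of_def)
      with zs show "zs \<in> f ` C"
        by (intro image_eqI[of _ _ "(as, bs)"]) (auto simp: C_def f_def partitions_of_def)
    qed
  qed
  moreover have "bij_betw g C (partitions_of n \<inter> fixed_point_free_partitions (Suc j))"
  proof (rule bij_betw_imageI)
    show "inj_on g C"
    proof (rule inj_onI, clarify)
      fix as bs cs ds
      assume C: "(as, bs) \<in> C" "(cs, ds) \<in> C" and eq: "g (as, bs) = g (cs, ds)"
      have "length as = length cs"
        using C eq
        by (intro le_antisym map_Suc_append_split_unique[of as bs cs ds "Suc j"]
            map_Suc_append_split_unique[of cs ds as bs "Suc j"])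
          (simp_all add: C_def g_def is_partition_append_Cons)
      then show "as = cs \<and> bs = ds"
        using eq by (simp add: g_def)
    qed
    \<comment> \<open>The bounds settle all comparisons across the joins, and they make the entries
      of \<open>as\<close> positive even before the shift.\<close>
    have part: "is_partition (as @ (length as + Suc j) # bs) \<longleftrightarrow> is_partition (map Suc as @ bs)"
      if "\<forall>x\<in>set as. length as + Suc j \<le> x" "\<forall>x\<in>set bs. x \<le> length as + Suc j"
      for as bs
      using that unfolding is_partition_append_Cons is_partition_append
      by (fastforce simp: is_partition_def sorted_wrt_map)
    show "g ` C = partitions_of n \<inter> fixed_point_free_partitions (Suc j)"
    proof (intro equalityI subsetI)
      fix ys assume "ys \<in> g ` C"
      then obtain as bs where ys: "ys = map Suc as @ bs"
          and p: "is_partition (as @ (length as + Suc j) # bs)"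
          and s: "length as + sum_list as + sum_list bs = n"
        by (auto simp: C_def g_def)
      have large: "\<forall>x\<in>set as. length as + Suc j \<le> x"
        and small: "\<forall>x\<in>set bs. x \<le> length as + Suc j"
        using p by (auto simp: is_partition_append_Cons)
      have "ys ! k \<noteq> k + Suc (Suc j)" if "k < length ys" for k
      proof (cases "k < length as")
        case True
        then have "length as + Suc j \<le> as ! k" using large by simp
        with True show ?thesis by (simp add: ys nth_append)
      next
        case False
        then have "ys ! k \<in> set bs" using that by (simp add: ys nth_append)
        with small have "ys ! k \<le> length as + Suc j" by blast
        with False show ?thesis by simp
      qed
      then show "ys \<in> partitions_of n \<inter> fixed_point_free_partitions (Suc j)"
        using part[OF large small] p s
        by (simp add: fixed_point_free_partitions_iff partitions_of_def ys sum_map_Suc)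
    next
      fix ys assume y: "ys \<in> partitions_of n \<inter> fixed_point_free_partitions (Suc j)"
      obtain as bs where ys: "ys = map Suc as @ bs"
          and b: "\<forall>x\<in>set as. length as + Suc j \<le> x" "\<forall>x\<in>set bs. x \<le> length as + Suc j"
        using fixed_point_free_split y by blast
      show "ys \<in> g ` C"
        using y part[OF b]
        by (intro image_eqI[of _ _ "(as, bs)"])
          (auto simp: C_def g_def partitions_of_def ys sum_map_Suc)
    qed
  qed
  ultimately show ?thesis
    by (metis bij_betw_same_card)
qed

section \<open>Small weights and the induction\<close>

lemma part_le_weight: "xs \<in> partitions_of n \<Longrightarrow> x \<in> set xs \<Longrightarrow> x \<le> n"
  by (auto simp: partitions_of_def member_le_sum_list)

lemma partitions_subset_mex_partitions:
  assumes "n \<le> j"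
  shows "partitions_of n \<subseteq> mex_partitions j"
proof
  fix xs assume xs: "xs \<in> partitions_of n"
  then have "is_partition xs" by (simp add: partitions_of_def)
  then show "xs \<in> mex_partitions j"
    using not_mex_partitions_iff[of xs j] part_le_weight[OF xs, of "Suc j"] assms by auto
qed

lemma partitions_subset_fixed_point_free:
  assumes "n \<le> j"
  shows "partitions_of n \<subseteq> fixed_point_free_partitions j"
proof
  fix xs assume xs: "xs \<in> partitions_of n"
  have "xs ! k \<noteq> k + Suc j" if "k < length xs" for k
    using part_le_weight[OF xs nth_mem[OF that]] assms by simp
  then show "xs \<in> fixed_point_free_partitions j"
    using xs by (simp add: fixed_point_free_partitions_iff partitions_of_def)
qed

theorem theorem1p10:
  fixes j n :: nat
  shows "card (partitions_of n \<inter> mex_partitions j) = card (partitions_of n \<inter> fixed_point_free_partitions j)"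
proof (induction n arbitrary: j rule: less_induct)
  case (less n)
  show ?case
  proof (cases "n \<le> j")
    case True
    then show ?thesis
      using partitions_subset_mex_partitions partitions_subset_fixed_point_free
      by (simp add: Int_absorb2)
  next
    case False
    \<comment> \<open>Since \<open>m < n\<close>, the induction hypothesis applies, with
      \<open>Suc j\<close> in place of \<open>j\<close>. It equates the sizes of the two
      complements.\<close>
    define m where "m = n - Suc j"
    have n: "n = m + Suc j" using False by (simp add: m_def)
    have "card (partitions_of n - mex_partitions j) =
        card (partitions_of n - fixed_point_free_partitions j)"
      using less[of m "Suc j"] unfolding n card_not_mex_partitions card_not_fixed_point_free
      by simp
    moreover have "card (partitions_of n \<inter> A) = card (partitions_of n) - card (partitions_of n - A)"
      for A
      by (metis Diff_Diff_Int Diff_subset card_Diff_subset finite_Diff finite_partitions_of)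
    ultimately show ?thesis by simp
  qed
qed

end
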